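(* Let $m \geq n \geq 1$ be integers, and let $k_1, k_2$ be integers with $1 \leq k_1 \leq \lfloor \frac{m}{n} \rfloor$ and $\lceil \frac{m}{n} \rceil \leq k_2 < \lfloor \frac{m}{2} \rfloor$. Put $m^* = m - n k_1$ and $k_2^* = k_2 - k_1$. Let $N$ be the number of ways to distribute $m$ identical balls into $n$ distinct boxes so that each box contains at least $k_1$ and at most $k_2$ balls. (A) Suppose $\lfloor \frac{m^*}{2} \rfloor \leq k_2^* < \lfloor \frac{m}{2} \rfloor - k_1$. (A1) If $\lfloor \frac{m}{2} \rfloor - k_1 < m^*$, then $$N = \binom{m - n k_1 + n - 1}{n-1} - n \binom{m - n k_1 - (k_2 - k_1) + n - 2}{n-1}.$$ (A2) If $\lfloor \frac{m}{2} \rfloor - k_1 \geq m^*$ and $\lfloor \frac{m^*}{2} \rfloor \leq k_2^* < m^*$, then $$N = \binom{m - n k_1 + n - 1}{n-1} - n \binom{m - n k_1 - (k_2 - k_1) + n - 2}{n-1}.$$ (A3) If $\lfloor \frac{m}{2} \rfloor - k_1 \geq m^*$ and $m^* \leq k_2^* < \lfloor \frac{m}{2} \rfloor - k_1$, then $$N = \binom{m - n k_1 + n - 1}{n-1}.$$ (B) If $\lceil \frac{m^*}{n} \rceil \leq k_2^* < \lfloor \frac{m^*}{2} \rfloor$, then $$N = \binom{m^* + n - 1}{n - 1} - \sum_{\alpha = 1}^{\lfloor \frac{m^*}{k_2^* + 1} \rfloor} (-1)^{\alpha + 1} \binom{n}{\alpha} \binom{m^* - \alpha (k_2^* + 1)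 + n - 1}{n - 1}.$$
   Context: A distribution of $m$ identical balls into $n$ distinct boxes is an $n$-tuple $(X_1,\dots,X_n)$ of nonnegative integers with $X_1+\cdots+X_n=m$ (all balls are distributed with no remainder), where $X_i$ is the number of balls in box $i$. The number of ways is the number of such tuples satisfying the stated constraints. *)

theory Defs
  imports Complex_Main
begin

(* The tuple (X_1, ..., X_n) is a list of length n, with 0-based indices. *)
definition distributions :: "nat \<Rightarrow> nat \<Rightarrow> nat list set" where
  "distributions m n = {X. length X = n \<and> sum_list X = m}"

definition bounded_distributions :: "nat \<Rightarrow> nat \<Rightarrow> nat \<Rightarrow> nat \<Rightarrow> nat list set" where
  "bounded_distributions m n k1 k2 =
     {X \<in> distributions m n. \<forall>i<n. k1 \<le> X ! i \<and> X ! i \<le> k2}"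

lemma finite_distributions: "finite (distributions m n)"
proof (rule finite_subset)
  show "distributions m n \<subseteq> {X. set X \<subseteq> {..m} \<and> length X = n}"
    by (auto simp: distributions_def intro: member_le_sum_list)
  show "finite {X. set X \<subseteq> {..m} \<and> length X = n}"
    by (rule finite_lists_length_eq) simp
qed

lemma finite_bounded_distributions: "finite (bounded_distributions m n k1 k2)"
  using finite_distributions[of m n] by (simp add: bounded_distributions_def)

definition num_distributions :: "nat \<Rightarrow> nat \<Rightarrow> nat \<Rightarrow> nat \<Rightarrow> nat" where
  "num_distributions m n k1 k2 = card (bounded_distributions m n k1 k2)"

end

(*
  Subtracting k1 from every box leaves mstar balls with at most k2star in each box. The number of
  such tuples is a coefficient of (1 + X + ... + X^k2star)^n = (1 - X^(k2star + 1))^n * (1 - X)^-n.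
  Expanding the first factor gives an alternating sum whose term for alpha vanishes once
  alpha * (k2star + 1) > mstar; in case (A) at most the terms for alpha = 0 and alpha = 1 survive.
*)
theory Submission
  imports Defs "HOL-Computational_Algebra.Formal_Power_Series"
begin

unbundle fps_syntax

text \<open>Classify the lists by their head \<open>i\<close>. Since \<open>i\<close> is a summand
  of \<open>m\<close>, the range stops at \<open>m\<close>, so \<open>m - i\<close> is a true
  difference. The recursion has the shape of a Cauchy product.\<close>

lemma card_lists_Suc_sum:
  fixes A :: "nat set"
  shows "card {X. length X = Suc n \<and> set X \<subseteq> A \<and> sum_list X = m} =
    (\<Sum>i\<in>{0..m} \<inter> A. card {X. length X = n \<and> set X \<subseteq> A \<and> sum_list X = m - i})"
    (is "card ?L = (\<Sum>i\<in>_. card (?T i))")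
proof -
  have fin: "finite (?T i)" for i
    by (rule finite_subset[OF _ finite_distributions[of "m - i" n]]) (auto simp: distributions_def)
  have split: "?L = (\<Union>i\<in>{0..m} \<inter> A. (#) i ` ?T i)"
    by (auto simp: length_Suc_conv image_iff)
  have "card ?L = (\<Sum>i\<in>{0..m} \<inter> A. card ((#) i ` ?T i))"
    unfolding split by (rule card_UN_disjoint) (use fin in auto)
  also have "\<dots> = (\<Sum>i\<in>{0..m} \<inter> A. card (?T i))"
    by (intro sum.cong refl card_image) auto
  finally show ?thesis .
qed

text \<open>Picking one exponent in \<open>A\<close> from each of the \<open>n\<close> factors is
  the same as choosing a list entry by entry. A general \<open>A\<close> serves both the bounded
  boxes, \<open>{..k}\<close>, and the unbounded ones, \<open>UNIV\<close>.\<close>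

lemma fps_indicator_power_nth:
  fixes A :: "nat set"
  shows "(Abs_fps (\<lambda>i. of_bool (i \<in> A)) ^ n :: int fps) $ m =
    int (card {X. length X = n \<and> set X \<subseteq> A \<and> sum_list X = m})"
proof (induction n arbitrary: m)
  case 0
  have "{X. length X = 0 \<and> set X \<subseteq> A \<and> sum_list X = m} = (if m = 0 then {[]} else {})"
    by auto
  then show ?case by simp
next
  case (Suc n)
  have "(Abs_fps (\<lambda>i. of_bool (i \<in> A)) ^ Suc n :: int fps) $ m =
      (\<Sum>i=0..m. of_bool (i \<in> A) * int (card {X. length X = n \<and> set X \<subseteq> A \<and> sum_list X = m - i}))"
    by (simp add: fps_mult_nth Suc.IH)
  also have "\<dots> = (\<Sum>i\<in>{0..m} \<inter> A. int (card {X. length X = n \<and> set X \<subseteq> A \<and> sum_list X = m - i}))"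
    by (rule sum.mono_neutral_cong_right) auto
  finally show ?case
    by (simp only: card_lists_Suc_sum of_nat_sum)
qed

text \<open>Finite geometric sum: the all-ones series stands for the inverse of 1 - X, and
  subtracting its shift by \<open>k + 1\<close> cancels every coefficient beyond
  \<open>k\<close>.\<close>

lemma fps_indicator_atMost:
  "Abs_fps (\<lambda>i. of_bool (i \<in> {..k})) =
    Abs_fps (\<lambda>i. of_bool (i \<in> (UNIV :: nat set))) * (1 - fps_X ^ (k + 1) :: int fps)"
  by (rule fps_ext) (auto simp: algebra_simps fps_X_power_mult_right_nth simp del: power_Suc)

lemma one_minus_fps_X_power_power:
  "(1 - fps_X ^ K) ^ n = (\<Sum>\<alpha>\<le>n. fps_const ((- 1) ^ \<alpha> * int (n choose \<alpha>)) * fps_X ^ (\<alpha> * K))"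
proof -
  have "(1 - fps_X ^ K) ^ n = (- (fps_X ^ K) + 1 :: int fps) ^ n"
    by simp
  also have "\<dots> = (\<Sum>\<alpha>\<le>n. of_nat (n choose \<alpha>) * (- (fps_X ^ K)) ^ \<alpha> * 1 ^ (n - \<alpha>))"
    by (rule binomial_ring)
  also have "\<dots> = (\<Sum>\<alpha>\<le>n. fps_const ((- 1) ^ \<alpha> * int (n choose \<alpha>)) * fps_X ^ (\<alpha> * K))"
  proof (rule sum.cong[OF refl])
    fix \<alpha>
    have "fps_const ((- 1) ^ \<alpha> * int (n choose \<alpha>)) = (- 1) ^ \<alpha> * (of_nat (n choose \<alpha>) :: int fps)"
      using fps_of_int[of "(- 1) ^ \<alpha> * int (n choose \<alpha>)", where 'a = int] by simp
    then show "of_nat (n choose \<alpha>) * (- (fps_X ^ K)) ^ \<alpha> * 1 ^ (n - \<alpha>) =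
        fps_const ((- 1) ^ \<alpha> * int (n choose \<alpha>)) * fps_X ^ (\<alpha> * K)"
      by (simp only: power_minus[of "fps_X ^ K"] power_mult[symmetric]
          power_one mult_1_left mult_ac)
  qed
  finally show ?thesis .
qed

lemma card_lists_atMost_sum:
  assumes "n \<ge> 1"
  shows "int (card {X. length X = n \<and> set X \<subseteq> {..k} \<and> sum_list X = m}) =
    (\<Sum>\<alpha>\<le>m div (k + 1).
      (- 1) ^ \<alpha> * int (n choose \<alpha>) * int ((m - \<alpha> * (k + 1) + n - 1) choose (n - 1)))"
proof -
  let ?G = "Abs_fps (\<lambda>i. of_bool (i \<in> (UNIV :: nat set))) :: int fps"
  let ?K = "k + 1"
  have G: "(?G ^ n) $ j = int ((j + n - 1) choose (n - 1))" for j
  proof -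
    have "(?G ^ n) $ j = int ((j + n - 1) choose j)"
      by (subst fps_indicator_power_nth) (simp add: card_length_sum_list)
    \<comment> \<open>Stars and bars gave the lower index \<open>j\<close>; passing to
      \<open>n - 1\<close> relies on \<open>n \<ge> 1\<close>, as otherwise \<open>n - 1\<close> is
      truncated.\<close>
    also have "(j + n - 1) choose j = (j + n - 1) choose (n - 1)"
      using assms by (subst binomial_symmetric) auto
    finally show ?thesis .
  qed
  have "int (card {X. length X = n \<and> set X \<subseteq> {..k} \<and> sum_list X = m}) =
      ((1 - fps_X ^ ?K) ^ n * ?G ^ n) $ m"
    by (simp only: fps_indicator_power_nth[symmetric] fps_indicator_atMost power_mult_distrib mult.commute)
  also have "\<dots> = (\<Sum>\<alpha>\<le>n. (- 1) ^ \<alpha> * int (n choose \<alpha>) *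
      (if m < \<alpha> * ?K then 0 else (?G ^ n) $ (m - \<alpha> * ?K)))"
    unfolding one_minus_fps_X_power_power sum_distrib_right fps_sum_nth mult.assoc
      fps_mult_left_const_nth fps_X_power_mult_nth ..
  \<comment> \<open>The terms with \<open>\<alpha> * ?K > m\<close> have to be cut off explicitly:
    under truncated subtraction their last binomial would be 1, not 0.\<close>
  also have "\<dots> = (\<Sum>\<alpha>\<in>{..n} \<inter> {..m div ?K}.
      (- 1) ^ \<alpha> * int (n choose \<alpha>) * int ((m - \<alpha> * ?K + n - 1) choose (n - 1)))"
    unfolding G
    by (rule sum.mono_neutral_cong_right)
       (auto simp: less_eq_div_iff_mult_less_eq not_le simp del: mult_Suc_right)
  \<comment> \<open>Indices beyond \<open>n\<close> may be added freely, because
    \<open>n choose \<alpha>\<close> is 0 there.\<close>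
  also have "\<dots> = (\<Sum>\<alpha>\<le>m div ?K.
      (- 1) ^ \<alpha> * int (n choose \<alpha>) * int ((m - \<alpha> * ?K + n - 1) choose (n - 1)))"
    by (rule sum.mono_neutral_left) (auto simp: binomial_eq_0)
  finally show ?thesis .
qed

lemma num_distributions_shift:
  assumes "n * k1 \<le> m" "k1 \<le> k2"
  shows "num_distributions m n k1 k2 =
    card {X. length X = n \<and> set X \<subseteq> {..k2 - k1} \<and> sum_list X = m - n * k1}" (is "_ = card ?S")
proof -
  have sum_shift: "sum_list (map (\<lambda>x. x + k1) X) = sum_list X + length X * k1" for X
    by (induction X) auto
  have bd: "bounded_distributions m n k1 k2 =
      {X. length X = n \<and> set X \<subseteq> {k1..k2} \<and> sum_list X = m}"
    by (auto simp: bounded_distributions_def distributions_def in_set_conv_nth subset_iff)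
  have "bij_betw (map (\<lambda>x. x + k1)) ?S (bounded_distributions m n k1 k2)"
  proof (rule bij_betw_byWitness[where f' = "map (\<lambda>x. x - k1)"])
    show "\<forall>X\<in>?S. map (\<lambda>x. x - k1) (map (\<lambda>x. x + k1) X) = X"
      by (simp add: comp_def)
    \<comment> \<open>Truncated subtraction is undone here because every entry is at least
      \<open>k1\<close>. The sum of the lowered list is later obtained from this identity and
      \<open>sum_shift\<close>.\<close>
    show unshift: "\<forall>X\<in>bounded_distributions m n k1 k2. map (\<lambda>x. x + k1) (map (\<lambda>x. x - k1) X) = X"
      unfolding bd by (auto intro!: map_idI)
    show "map (\<lambda>x. x + k1) ` ?S \<subseteq> bounded_distributions m n k1 k2"
      using assms unfolding bd by (fastforce simp: sum_shift)
    show "map (\<lambda>x. x - k1) ` bounded_distributions m n k1 k2 \<subseteq> ?S"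
    proof (rule image_subsetI)
      fix X assume X: "X \<in> bounded_distributions m n k1 k2"
      then have "sum_list X = sum_list (map (\<lambda>x. x - k1) X) + length X * k1"
        using unshift sum_shift[of "map (\<lambda>x. x - k1) X"] by simp
      then show "map (\<lambda>x. x - k1) X \<in> ?S"
        using X unfolding bd by (auto intro!: diff_le_mono)
    qed
  qed
  then show ?thesis
    by (simp add: num_distributions_def bij_betw_same_card)
qed

theorem mainTheorem5:
  fixes m n k1 k2 mstar k2star N :: nat
  assumes "m \<ge> n" and "n \<ge> 1"
    and "1 \<le> k1" and "int k1 \<le> \<lfloor>real m / real n\<rfloor>"
    and "\<lceil>real m / real n\<rceil> \<le> int k2" and "int k2 < \<lfloor>real m / 2\<rfloor>"
    and "mstar = m - n * k1" and "k2star = k2 - k1"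
    and "N = num_distributions m n k1 k2"
  shows
    "(\<lfloor>real mstar / 2\<rfloor> \<le> int k2star \<and> int k2star < \<lfloor>real m / 2\<rfloor> - int k1 \<longrightarrow>
        (\<lfloor>real m / 2\<rfloor> - int k1 < int mstar \<longrightarrow>
           int N = int ((m - n * k1 + n - 1) choose (n - 1))
                   - int n * int ((m - n * k1 - (k2 - k1) + n - 2) choose (n - 1))) \<and>
        (\<lfloor>real m / 2\<rfloor> - int k1 \<ge> int mstar \<and>
         \<lfloor>real mstar / 2\<rfloor> \<le> int k2star \<and> k2star < mstar \<longrightarrow>
           int N = int ((m - n * k1 + n - 1) choose (n - 1))
                   - int n * int ((m - n * k1 - (k2 - k1) + n - 2) choose (n - 1))) \<and>
        (\<lfloor>real m / 2\<rfloor> - int k1 \<ge> int mstar \<and>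
         mstar \<le> k2star \<and> int k2star < \<lfloor>real m / 2\<rfloor> - int k1 \<longrightarrow>
           N = (m - n * k1 + n - 1) choose (n - 1))) \<and>
     (\<lceil>real mstar / real n\<rceil> \<le> int k2star \<and> int k2star < \<lfloor>real mstar / 2\<rfloor> \<longrightarrow>
        int N = int ((mstar + n - 1) choose (n - 1))
                - (\<Sum>\<alpha> = 1..nat \<lfloor>real mstar / real (k2star + 1)\<rfloor>.
                     (- 1) ^ (\<alpha> + 1) * int (n choose \<alpha>)
                     * int ((mstar - \<alpha> * (k2star + 1) + n - 1) choose (n - 1))))"
proof -
  have k1: "n * k1 \<le> m"
  proof -
    have "real k1 \<le> real m / real n"
      using assms(4) by (simp add: le_floor_iff)
    then have "real (n * k1) \<le> real m"
      using assms(2) by (simp add: field_simps)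
    then show ?thesis by (simp only: of_nat_le_iff)
  qed
  have "int k1 \<le> int k2"
    using assms(4,5) floor_le_ceiling[of "real m / real n"] by linarith
  then have k12: "k1 \<le> k2" by simp
  define c where "c \<alpha> = (- 1) ^ \<alpha> * int (n choose \<alpha>) *
    int ((mstar - \<alpha> * (k2star + 1) + n - 1) choose (n - 1))" for \<alpha>
  have N: "int N = (\<Sum>\<alpha>\<le>mstar div (k2star + 1). c \<alpha>)"
    unfolding assms(9) num_distributions_shift[OF k1 k12] c_def assms(7,8)
    by (rule card_lists_atMost_sum[OF assms(2)])
  have c0: "c 0 = int ((m - n * k1 + n - 1) choose (n - 1))"
    by (simp add: c_def assms(7))
  have half: "\<lfloor>real j / 2\<rfloor> = int (j div 2)" for j
    using floor_divide_of_nat_eq[of j 2] by simp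
  have one: "int N = int ((m - n * k1 + n - 1) choose (n - 1))
      - int n * int ((m - n * k1 - (k2 - k1) + n - 2) choose (n - 1))"
    if "mstar div 2 \<le> k2star" "k2star < mstar"
  proof -
    \<comment> \<open>The two assumptions say that
      \<open>k2star + 1 \<le> mstar < 2 * (k2star + 1)\<close>.\<close>
    have "mstar div (k2star + 1) = 1"
      using that by (intro div_nat_eqI) auto
    then have "int N = c 0 + c 1"
      by (simp add: N)
    \<comment> \<open>The extra 1 in \<open>k2star + 1\<close> turns \<open>n - 1\<close> into
      \<open>n - 2\<close>; no truncation interferes, since \<open>k2star < mstar\<close> and
      \<open>n \<ge> 1\<close>.\<close>
    moreover have "mstar - 1 * (k2star + 1) + n - 1 = m - n * k1 - (k2 - k1) + n - 2"
      using that assms(7,8) by auto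
    then have "c 1 = - (int n * int ((m - n * k1 - (k2 - k1) + n - 2) choose (n - 1)))"
      unfolding c_def by simp
    ultimately show ?thesis
      by (simp add: c0)
  qed
  \<comment> \<open>The quotient \<open>mstar div (k2star + 1)\<close> is 0, leaving only
    \<open>c 0\<close>: the upper bound excludes nothing.\<close>
  have zero: "N = (m - n * k1 + n - 1) choose (n - 1)" if "mstar \<le> k2star"
    using N that by (simp add: c0)
  have many: "int N = int ((mstar + n - 1) choose (n - 1))
      - (\<Sum>\<alpha> = 1..nat \<lfloor>real mstar / real (k2star + 1)\<rfloor>.
          (- 1) ^ (\<alpha> + 1) * int (n choose \<alpha>)
          * int ((mstar - \<alpha> * (k2star + 1) + n - 1) choose (n - 1)))"
  proof -
    have "nat \<lfloor>real mstar / real (k2star + 1)\<rfloor> = mstar div (k2star + 1)"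
      by (simp only: floor_divide_of_nat_eq nat_int)
    \<comment> \<open>With \<open>c 0\<close> split off, the exponent \<open>\<alpha> + 1\<close> in
      the goal accounts for the minus sign in front of the remaining sum.\<close>
    moreover have "int N = c 0 + (\<Sum>\<alpha> = 1..mstar div (k2star + 1). c \<alpha>)"
      unfolding N atMost_atLeast0 by (subst sum.atLeast_Suc_atMost) auto
    ultimately show ?thesis
      by (simp add: c0 assms(7) c_def sum_negf)
  qed
  \<comment> \<open>\<open>one\<close> settles both (A1) and (A2): in (A1),
    \<open>k2star < mstar\<close> follows by transitivity through \<open>m div 2 - k1\<close>.
    \<open>zero\<close> gives (A3) and \<open>many\<close> gives (B).\<close>
  show ?thesis
    unfolding half using one zero many by auto
qed

end
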